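(* Let $\star$ be a semistar operation on an integral domain $D$ with quotient field $K$ and let $I$ be a nonzero $D$-submodule of $K$. Then $I$ is quasi-$\star_f$-invertible if and only if $I$ and $(D^\star:I)$ are $\star_f$-finite (hence, $\star$-finite) and $I$ is quasi-$\star$-invertible.
   Context: Let $D$ be an integral domain with quotient field $K$; $\overline{F}(D)$ is the set of nonzero $D$-submodules of $K$. A semistar operation on $D$ is a map $\star:\overline{F}(D)\to\overline{F}(D)$, $E\mapsto E^\star$, such that for all $0\ne x\in K$ and $E,F\in\overline{F}(D)$: $(xE)^\star=xE^\star$; $E\subseteq F$ implies $E^\star\subseteq F^\star$; $E\subseteq E^\star$ and $(E^\star)^\star=E^\star$. The semistar operation of finite type associated to $\star$ is $\star_f$, defined by $E^{\star_f}=\bigcup\{F^\star : F\subseteq E,\ F \text{ a nonzero finitely generated } D\text{-submodule of } K\}$. For $E,F\in\overline{F}(D)$, $(E:F)=\{z\in K: zF\subseteq E\}$. For a semistar operation $\ast$: an element $I\in\overline{F}(D)$ is quasi-$\ast$-invertible if $(I(D^{\ast}:I))^{\ast}=D^{\ast}$ (in particular $(D^{\ast}:I)\neq 0$); an element $E\in\overline{F}(D)$ is $\ast$-finite if there exists a nonzero finitely generated $D$-submodule $J$ of $K$ with $J^{\ast}=E^{\ast}$ (it is not required that $J\subseteq E$). *)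

theory Defs
  imports "HOL-Computational_Algebra.Polynomial_Factorial"
begin

text \<open>
  The domain \<open>D\<close> is a type \<open>'a :: idom\<close> and its quotient field \<open>K\<close> is the library's \<open>'a fract\<close>,
  so that \<open>D\<close> as a subset of \<open>K\<close> is the range of the canonical embedding \<^const>\<open>to_fract\<close>.
\<close>

definition dom_in_fract :: "'a::idom fract set"
  where "dom_in_fract = range to_fract"

definition fract_scale :: "'a::idom \<Rightarrow> 'a fract \<Rightarrow> 'a fract"
  where "fract_scale d x = to_fract d * x"

global_interpretation fract_module: module fract_scale
  by standard (simp_all add: fract_scale_def algebra_simps)

definition nonzero_submodules :: "'a::idom fract set set"
  where "nonzero_submodules = {E. fract_module.subspace E \<and> E \<noteq> {0}}"

definition fg_nonzero_submodules :: "'a::idom fract set set"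
  where "fg_nonzero_submodules =
    {F \<in> nonzero_submodules. \<exists>S. finite S \<and> F = fract_module.span S}"

definition submodule_mult :: "'a::idom fract set \<Rightarrow> 'a fract set \<Rightarrow> 'a fract set"
  where "submodule_mult E F = fract_module.span {x * y | x y. x \<in> E \<and> y \<in> F}"

definition submodule_colon :: "'a::idom fract set \<Rightarrow> 'a fract set \<Rightarrow> 'a fract set"
  where "submodule_colon E F = {z. (\<lambda>x. z * x) ` F \<subseteq> E}"

text \<open>
  An operation is a total function on subsets of \<open>K\<close>; its values outside the nonzero submodules
  carry no meaning and are not constrained. The notions below therefore ask explicitly that the
  sets the operation is applied to are nonzero submodules.
\<close>

definition semistar_operation :: "('a::idom fract set \<Rightarrow> 'a fract set) \<Rightarrow> bool"
  where "semistar_operation star \<longleftrightarrow>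
    (\<forall>E \<in> nonzero_submodules. star E \<in> nonzero_submodules) \<and>
    (\<forall>x. \<forall>E \<in> nonzero_submodules. x \<noteq> 0 \<longrightarrow>
      star ((\<lambda>y. x * y) ` E) = (\<lambda>y. x * y) ` star E) \<and>
    (\<forall>E \<in> nonzero_submodules. \<forall>F \<in> nonzero_submodules. E \<subseteq> F \<longrightarrow> star E \<subseteq> star F) \<and>
    (\<forall>E \<in> nonzero_submodules. E \<subseteq> star E \<and> star (star E) = star E)"

definition finite_type_of ::
    "('a::idom fract set \<Rightarrow> 'a fract set) \<Rightarrow> 'a fract set \<Rightarrow> 'a fract set"
  where "finite_type_of star E = \<Union>{star F | F. F \<in> fg_nonzero_submodules \<and> F \<subseteq> E}"

text \<open>
  The condition that the colon module is nonzero makes the product a nonzero submodule, so that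
  the operation may be applied to it.
\<close>

definition quasi_star_invertible ::
    "('a::idom fract set \<Rightarrow> 'a fract set) \<Rightarrow> 'a fract set \<Rightarrow> bool"
  where "quasi_star_invertible star I \<longleftrightarrow>
    I \<in> nonzero_submodules \<and>
    submodule_colon (star dom_in_fract) I \<noteq> {0} \<and>
    star (submodule_mult I (submodule_colon (star dom_in_fract) I)) = star dom_in_fract"

definition star_finite :: "('a::idom fract set \<Rightarrow> 'a fract set) \<Rightarrow> 'a fract set \<Rightarrow> bool"
  where "star_finite star E \<longleftrightarrow>
    E \<in> nonzero_submodules \<and> (\<exists>J \<in> fg_nonzero_submodules. star J = star E)"

end

theory Submission
  imports Defs
begin

text \<open>
  Write \<open>C = (D\<^sup>\<star> : I)\<close> and \<open>f = \<star>\<^sub>f\<close>. Since \<open>D\<close> is finitely generated, \<open>D\<^sup>f = D\<^sup>\<star>\<close>, so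
  \<open>I C \<subseteq> D\<^sup>\<star>\<close> reduces both notions of invertibility to the question of whether \<open>1\<close> lies in
  \<open>(I C)\<^sup>f\<close> or in \<open>(I C)\<^sup>\<star>\<close> (\<open>star_mult_eq_unit_iff\<close>).

  If \<open>1 \<in> (I C)\<^sup>f\<close>, then \<open>1\<close> already lies in \<open>(G H)\<^sup>\<star>\<close> for finitely generated \<open>G \<subseteq> I\<close> and
  \<open>H \<subseteq> C\<close>, because a finite set of sums of products involves only finitely many factors. These
  submodules determine \<open>I\<close> and \<open>C\<close> up to closure: for \<open>x \<in> I\<close> one has
  \<open>x = x \<cdot> 1 \<in> (x H G)\<^sup>\<star> \<subseteq> (D\<^sup>\<star> G)\<^sup>\<star> = G\<^sup>\<star>\<close>, hence \<open>I\<^sup>f = G\<^sup>f\<close>; exchanging the roles of the two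
  factors gives \<open>C\<^sup>f = H\<^sup>f\<close> (\<open>star_finite_factor\<close>).

  Conversely, if \<open>I\<^sup>f = G\<^sup>f\<close> and \<open>C\<^sup>f = H\<^sup>f\<close> with \<open>G\<close> and \<open>H\<close> finitely generated, then
  \<open>1 \<in> (I C)\<^sup>\<star> \<subseteq> (G H)\<^sup>\<star>\<close>. As \<open>G H\<close> is finitely generated, the last set is \<open>(G H)\<^sup>f\<close>, which is
  contained in \<open>(I\<^sup>f C\<^sup>f)\<^sup>f = (I C)\<^sup>f\<close>.

  Both directions use that \<open>f\<close> is itself a semistar operation (\<open>semistar_finite_type_of\<close>), so that
  every statement about products and closures is available for \<open>\<star>\<close> and for \<open>f\<close> alike.
\<close>

section \<open>Submodules of the quotient field\<close>

lemma subspace_fractI: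
  assumes "0 \<in> E" "\<And>x y. x \<in> E \<Longrightarrow> y \<in> E \<Longrightarrow> x + y \<in> E"
    and "\<And>d x. x \<in> E \<Longrightarrow> to_fract d * x \<in> E"
  shows "fract_module.subspace E"
  using assms by (auto simp: fract_module.subspace_def fract_scale_def)

lemma subspace_scaleD:
  assumes "fract_module.subspace E" "x \<in> E"
  shows "to_fract d * x \<in> E"
  using fract_module.subspace_scale[OF assms, of d] by (simp add: fract_scale_def)

lemma nonzero_submodulesD: "E \<in> nonzero_submodules \<Longrightarrow> fract_module.subspace E"
  by (simp add: nonzero_submodules_def)

lemma nonzero_submodulesI:
  assumes "fract_module.subspace E" "x \<in> E" "x \<noteq> 0"
  shows "E \<in> nonzero_submodules"
  using assms by (auto simp: nonzero_submodules_def)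

lemma nonzero_submodules_mono:
  assumes "fract_module.subspace F" "E \<in> nonzero_submodules" "E \<subseteq> F"
  shows "F \<in> nonzero_submodules"
  using assms fract_module.subspace_0[of E] by (auto simp: nonzero_submodules_def)

lemma nonzero_submodulesE:
  assumes "E \<in> nonzero_submodules"
  obtains x where "x \<in> E" "x \<noteq> 0"
  using assms fract_module.subspace_0[of E] by (auto simp: nonzero_submodules_def)

lemma fg_nonzero_submodulesI:
  assumes "finite S" "fract_module.span S \<noteq> {0}"
  shows "fract_module.span S \<in> fg_nonzero_submodules"
  using assms by (auto simp: fg_nonzero_submodules_def nonzero_submodules_def)

lemma fg_nonzero_submodulesE:
  assumes "F \<in> fg_nonzero_submodules"
  obtains S where "finite S" "F = fract_module.span S"
  using assms by (auto simp: fg_nonzero_submodules_def)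

lemma fg_imp_nonzero: "F \<in> fg_nonzero_submodules \<Longrightarrow> F \<in> nonzero_submodules"
  by (simp add: fg_nonzero_submodules_def)

lemma fg_submodule_exists:
  assumes "E \<in> nonzero_submodules"
  shows "\<exists>F \<in> fg_nonzero_submodules. F \<subseteq> E"
proof -
  obtain x where x: "x \<in> E" "x \<noteq> 0" using assms by (rule nonzero_submodulesE)
  have "x \<in> fract_module.span {x}" by (simp add: fract_module.span_base)
  then have "fract_module.span {x} \<in> fg_nonzero_submodules"
    using x by (intro fg_nonzero_submodulesI) auto
  moreover have "fract_module.span {x} \<subseteq> E"
    using x assms by (intro fract_module.span_minimal) (auto dest: nonzero_submodulesD)
  ultimately show ?thesis by blast
qed

lemma fg_submodule_join:
  assumes "F \<in> fg_nonzero_submodules" "G \<in> fg_nonzero_submodules"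
    and "fract_module.subspace E" "F \<subseteq> E" "G \<subseteq> E"
  shows "\<exists>H \<in> fg_nonzero_submodules. F \<subseteq> H \<and> G \<subseteq> H \<and> H \<subseteq> E"
proof -
  obtain S where S: "finite S" "F = fract_module.span S"
    using assms(1) by (rule fg_nonzero_submodulesE)
  obtain T where T: "finite T" "G = fract_module.span T"
    using assms(2) by (rule fg_nonzero_submodulesE)
  let ?H = "fract_module.span (S \<union> T)"
  have F: "F \<subseteq> ?H" and G: "G \<subseteq> ?H"
    using S T by (simp_all add: fract_module.span_mono)
  have "?H \<in> nonzero_submodules"
    using nonzero_submodules_mono[OF _ fg_imp_nonzero[OF assms(1)] F] by simp
  then have "?H \<in> fg_nonzero_submodules"
    using S T by (intro fg_nonzero_submodulesI) (auto simp: nonzero_submodules_def)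
  moreover have "?H \<subseteq> E"
    using S T assms(3-5) by (intro fract_module.span_minimal) (auto intro: fract_module.span_base)
  ultimately show ?thesis using F G by blast
qed

lemma subspace_image_mult:
  assumes "fract_module.subspace E"
  shows "fract_module.subspace ((\<lambda>y. x * y) ` E)"
proof (rule subspace_fractI)
  show "0 \<in> (\<lambda>y. x * y) ` E"
    using fract_module.subspace_0[OF assms] by force
next
  fix u v assume "u \<in> (\<lambda>y. x * y) ` E" "v \<in> (\<lambda>y. x * y) ` E"
  then show "u + v \<in> (\<lambda>y. x * y) ` E"
    using fract_module.subspace_add[OF assms] by (auto simp flip: distrib_left)
next
  fix d u assume "u \<in> (\<lambda>y. x * y) ` E"
  then obtain y where y: "y \<in> E" "u = x * y" by blast
  then have "to_fract d * u = x * (to_fract d * y)" by (simp add: ac_simps)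
  then show "to_fract d * u \<in> (\<lambda>y. x * y) ` E"
    using subspace_scaleD[OF assms y(1), of d] by blast
qed

lemma image_mult_nonzero_submodules:
  assumes "E \<in> nonzero_submodules" "x \<noteq> 0"
  shows "(\<lambda>y. x * y) ` E \<in> nonzero_submodules"
proof -
  obtain y where "y \<in> E" "y \<noteq> 0" using assms(1) by (rule nonzero_submodulesE)
  then show ?thesis
    using assms subspace_image_mult[OF nonzero_submodulesD[OF assms(1)]]
    by (intro nonzero_submodulesI[of _ "x * y"]) auto
qed

lemma image_mult_inverse:
  fixes x :: "'a::field"
  assumes "x \<noteq> 0"
  shows "(\<lambda>y. inverse x * y) ` (\<lambda>y. x * y) ` E = E" "(\<lambda>y. x * y) ` (\<lambda>y. inverse x * y) ` E = E"
  using assms by (simp_all add: image_image flip: mult.assoc)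

lemma image_mult_fg:
  assumes "F \<in> fg_nonzero_submodules" "x \<noteq> 0"
  shows "(\<lambda>y. x * y) ` F \<in> fg_nonzero_submodules"
proof -
  obtain S where S: "finite S" "F = fract_module.span S"
    using assms(1) by (rule fg_nonzero_submodulesE)
  have hom: "module_hom fract_scale fract_scale (\<lambda>y. x * y)"
    by unfold_locales (simp_all add: fract_scale_def algebra_simps)
  have "(\<lambda>y. x * y) ` F = fract_module.span ((\<lambda>y. x * y) ` S)"
    using module_hom.span_image[OF hom] S by simp
  then show ?thesis
    using S image_mult_nonzero_submodules[OF fg_imp_nonzero[OF assms(1)] assms(2)]
    by (auto simp: fg_nonzero_submodules_def)
qed

lemma subspace_colon:
  assumes "fract_module.subspace E"
  shows "fract_module.subspace (submodule_colon E F)"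
proof (rule subspace_fractI)
  show "0 \<in> submodule_colon E F"
    using fract_module.subspace_0[OF assms] by (auto simp: submodule_colon_def)
next
  fix x y assume "x \<in> submodule_colon E F" "y \<in> submodule_colon E F"
  then show "x + y \<in> submodule_colon E F"
    using fract_module.subspace_add[OF assms] by (auto simp: submodule_colon_def distrib_right)
next
  fix d x assume "x \<in> submodule_colon E F"
  then show "to_fract d * x \<in> submodule_colon E F"
    using subspace_scaleD[OF assms] by (auto simp: submodule_colon_def mult.assoc)
qed

lemma dom_in_fract_fg: "(dom_in_fract :: 'a::idom fract set) \<in> fg_nonzero_submodules"
proof -
  have "(dom_in_fract :: 'a fract set) = fract_module.span {1}"
    by (auto simp: dom_in_fract_def fract_module.span_singleton fract_scale_def)
  moreover have "1 \<in> fract_module.span {1 :: 'a fract}"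
    by (rule fract_module.span_base) simp
  then have "fract_module.span {1 :: 'a fract} \<noteq> {0}" by auto
  ultimately show ?thesis
    using fg_nonzero_submodulesI[of "{1 :: 'a fract}"] by simp
qed

lemma one_in_dom: "1 \<in> dom_in_fract"
  unfolding dom_in_fract_def by (metis rangeI to_fract_1)

lemma dom_subset_iff:
  assumes "fract_module.subspace E"
  shows "dom_in_fract \<subseteq> E \<longleftrightarrow> 1 \<in> E"
  using one_in_dom subspace_scaleD[OF assms, of 1] by (auto simp: dom_in_fract_def)

section \<open>Products of submodules\<close>

lemma submodule_multI: "x \<in> E \<Longrightarrow> y \<in> F \<Longrightarrow> x * y \<in> submodule_mult E F"
  unfolding submodule_mult_def by (rule fract_module.span_base) blast

lemma submodule_mult_least:
  assumes "fract_module.subspace T" "\<And>x y. x \<in> E \<Longrightarrow> y \<in> F \<Longrightarrow> x * y \<in> T"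
  shows "submodule_mult E F \<subseteq> T"
  unfolding submodule_mult_def using assms by (intro fract_module.span_minimal) auto

lemma subspace_submodule_mult: "fract_module.subspace (submodule_mult E F)"
  by (simp add: submodule_mult_def)

lemma submodule_mult_mono:
  "E \<subseteq> E' \<Longrightarrow> F \<subseteq> F' \<Longrightarrow> submodule_mult E F \<subseteq> submodule_mult E' F'"
  by (intro submodule_mult_least subspace_submodule_mult) (blast intro: submodule_multI)

lemma submodule_mult_commute:
  fixes E F :: "'a::idom fract set"
  shows "submodule_mult E F = submodule_mult F E"
proof -
  have "submodule_mult E F \<subseteq> submodule_mult F E" for E F :: "'a fract set"
    by (intro submodule_mult_least subspace_submodule_mult) (metis mult.commute submodule_multI)
  then show ?thesis by blast
qed

lemma submodule_mult_nonzero: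
  assumes "E \<in> nonzero_submodules" "F \<in> nonzero_submodules"
  shows "submodule_mult E F \<in> nonzero_submodules"
proof -
  obtain x where "x \<in> E" "x \<noteq> 0" using assms(1) by (rule nonzero_submodulesE)
  moreover obtain y where "y \<in> F" "y \<noteq> 0" using assms(2) by (rule nonzero_submodulesE)
  ultimately show ?thesis
    by (intro nonzero_submodulesI[of _ "x * y"] subspace_submodule_mult) (auto intro: submodule_multI)
qed

lemma submodule_mult_span:
  "submodule_mult (fract_module.span A) (fract_module.span B) =
    fract_module.span {x * y | x y. x \<in> A \<and> y \<in> B}" (is "?L = ?R")
proof
  have *: "fract_module.span X \<subseteq> submodule_colon ?R Y"
    if "\<And>x y. x \<in> X \<Longrightarrow> y \<in> Y \<Longrightarrow> x * y \<in> ?R" for X Y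
    using that by (intro fract_module.span_minimal subspace_colon) (auto simp: submodule_colon_def)
  have "fract_module.span A \<subseteq> submodule_colon ?R B"
    by (rule *) (rule fract_module.span_base, blast)
  then have "y * x \<in> ?R" if "y \<in> B" "x \<in> fract_module.span A" for x y
    using that by (auto simp: submodule_colon_def mult.commute)
  then have "fract_module.span B \<subseteq> submodule_colon ?R (fract_module.span A)"
    by (rule *)
  then have "x * y \<in> ?R" if "x \<in> fract_module.span A" "y \<in> fract_module.span B" for x y
    using that by (subst mult.commute) (auto simp: submodule_colon_def)
  then show "?L \<subseteq> ?R"
    by (intro submodule_mult_least) simp_all
  show "?R \<subseteq> ?L"
    by (intro fract_module.span_minimal subspace_submodule_mult)
      (auto intro!: submodule_multI fract_module.span_base)
qed

lemma submodule_mult_fg: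
  assumes "F \<in> fg_nonzero_submodules" "G \<in> fg_nonzero_submodules"
  shows "submodule_mult F G \<in> fg_nonzero_submodules"
proof -
  obtain A where A: "finite A" "F = fract_module.span A"
    using assms(1) by (rule fg_nonzero_submodulesE)
  obtain B where B: "finite B" "G = fract_module.span B"
    using assms(2) by (rule fg_nonzero_submodulesE)
  have "finite {x * y | x y. x \<in> A \<and> y \<in> B}"
    using finite_image_set2[of "\<lambda>x. x \<in> A" "\<lambda>y. y \<in> B" "(*)"] A(1) B(1) by simp
  then show ?thesis
    using A B submodule_mult_nonzero[OF assms[THEN fg_imp_nonzero]]
    by (auto simp: fg_nonzero_submodules_def submodule_mult_span)
qed

lemma finite_subset_span:
  assumes "finite S" "S \<subseteq> fract_module.span X"
  shows "\<exists>T. finite T \<and> T \<subseteq> X \<and> S \<subseteq> fract_module.span T"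
  using assms
proof (induction S)
  case empty
  then show ?case by (intro exI[of _ "{}"]) auto
next
  case (insert s S)
  obtain T where T: "finite T" "T \<subseteq> X" "S \<subseteq> fract_module.span T"
    using insert by auto
  obtain U r where U: "finite U" "U \<subseteq> X" "s = (\<Sum>a\<in>U. fract_scale (r a) a)"
    using insert.prems by (auto simp: fract_module.span_explicit)
  have "s \<in> fract_module.span U"
    unfolding U(3)
    by (intro fract_module.span_sum fract_module.span_scale fract_module.span_base)
  then have "insert s S \<subseteq> fract_module.span (T \<union> U)"
    using T(3) fract_module.span_mono[of T "T \<union> U"] fract_module.span_mono[of U "T \<union> U"] by blast
  then show ?case using T(1,2) U(1,2) by (intro exI[of _ "T \<union> U"]) auto
qed

text \<open>
  Finitely many elements of \<open>E F\<close> are linear combinations of finitely many products \<open>x y\<close>, and the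
  left and right factors of these products generate the two submodules.
\<close>

lemma fg_subset_submodule_mult:
  assumes "L \<in> fg_nonzero_submodules" "L \<subseteq> submodule_mult E F"
    and "fract_module.subspace E" "fract_module.subspace F"
  shows "\<exists>G \<in> fg_nonzero_submodules. \<exists>H \<in> fg_nonzero_submodules.
    G \<subseteq> E \<and> H \<subseteq> F \<and> L \<subseteq> submodule_mult G H"
proof -
  obtain S where S: "finite S" "L = fract_module.span S"
    using assms(1) by (rule fg_nonzero_submodulesE)
  have "S \<subseteq> fract_module.span {x * y | x y. x \<in> E \<and> y \<in> F}"
    using assms(2) S(2) fract_module.span_superset unfolding submodule_mult_def by blast
  then obtain T where T: "finite T" "T \<subseteq> {x * y | x y. x \<in> E \<and> y \<in> F}" "S \<subseteq> fract_module.span T"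
    using finite_subset_span[OF S(1)] by meson
  have "T \<subseteq> (\<lambda>(x, y). x * y) ` (E \<times> F)" using T(2) by auto
  then obtain P where P: "P \<subseteq> E \<times> F" "finite P" "T = (\<lambda>(x, y). x * y) ` P"
    using finite_subset_image[OF T(1)] by meson
  define G where "G = fract_module.span (fst ` P)"
  define H where "H = fract_module.span (snd ` P)"
  have "T \<subseteq> submodule_mult G H"
  proof
    fix t assume "t \<in> T"
    then obtain x y where "(x, y) \<in> P" "t = x * y" using P(3) by auto
    moreover from this have "x \<in> fst ` P" "y \<in> snd ` P" by force+
    ultimately show "t \<in> submodule_mult G H"
      unfolding G_def H_def by (simp add: submodule_multI fract_module.span_base)
  qed
  then have "S \<subseteq> submodule_mult G H"
    using T(3) fract_module.span_minimal[OF _ subspace_submodule_mult] by blast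
  then have L: "L \<subseteq> submodule_mult G H"
    unfolding S(2) by (rule fract_module.span_minimal) (rule subspace_submodule_mult)
  have "submodule_mult G H \<noteq> {0}"
    using nonzero_submodules_mono[OF subspace_submodule_mult fg_imp_nonzero[OF assms(1)] L]
    by (simp add: nonzero_submodules_def)
  moreover have "submodule_mult G H \<subseteq> {0}" if "G = {0} \<or> H = {0}"
    using that by (intro submodule_mult_least) auto
  ultimately have "G \<noteq> {0}" "H \<noteq> {0}"
    using fract_module.subspace_0[OF subspace_submodule_mult, of G H] by blast+
  then have "G \<in> fg_nonzero_submodules" "H \<in> fg_nonzero_submodules"
    unfolding G_def H_def using P(2) by (simp_all add: fg_nonzero_submodulesI)
  moreover have "fst ` P \<subseteq> E" "snd ` P \<subseteq> F" using P(1) by auto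
  then have "G \<subseteq> E" "H \<subseteq> F"
    unfolding G_def H_def using assms(3,4) by (simp_all add: fract_module.span_minimal)
  ultimately show ?thesis using L by blast
qed

section \<open>Semistar operations\<close>

lemma semistarD:
  assumes "semistar_operation star" "E \<in> nonzero_submodules"
  shows semistar_nonzero: "star E \<in> nonzero_submodules"
    and semistar_subspace: "fract_module.subspace (star E)"
    and semistar_scale: "x \<noteq> 0 \<Longrightarrow> star ((\<lambda>y. x * y) ` E) = (\<lambda>y. x * y) ` star E"
    and semistar_extensive: "E \<subseteq> star E"
    and semistar_idem: "star (star E) = star E"
  using assms by (auto simp: semistar_operation_def nonzero_submodules_def)

lemma semistar_mono:
  assumes "semistar_operation star" "E \<in> nonzero_submodules" "F \<in> nonzero_submodules" "E \<subseteq> F"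
  shows "star E \<subseteq> star F"
  using assms by (simp add: semistar_operation_def)

lemma semistar_least:
  assumes "semistar_operation star" "E \<in> nonzero_submodules" "F \<in> nonzero_submodules"
    and "E \<subseteq> star F"
  shows "star E \<subseteq> star F"
  using semistar_mono[OF assms(1,2) semistar_nonzero[OF assms(1,3)] assms(4)]
  by (simp add: semistar_idem[OF assms(1,3)])

text \<open>
  For \<open>x \<noteq> 0\<close> this combines \<open>x E\<^sup>\<star> = (x E)\<^sup>\<star>\<close> with monotonicity and idempotence. The elementwise
  form includes \<open>x = 0\<close>, where \<open>x E\<close> lies outside the domain of \<open>\<star>\<close>; all computations with
  products below reduce to it.
\<close>

lemma semistar_mult_closed:
  assumes "semistar_operation star" "E \<in> nonzero_submodules" "T \<in> nonzero_submodules"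
    and "\<And>y. y \<in> E \<Longrightarrow> x * y \<in> star T" "z \<in> star E"
  shows "x * z \<in> star T"
proof (cases "x = 0")
  case True
  then show ?thesis
    using fract_module.subspace_0[OF semistar_subspace] assms(1,3) by auto
next
  case False
  have "star ((\<lambda>y. x * y) ` E) \<subseteq> star T"
    using assms(4)
    by (intro semistar_least[OF assms(1) image_mult_nonzero_submodules[OF assms(2) False] assms(3)]) auto
  then show ?thesis using assms(5) semistar_scale[OF assms(1,2) False] by blast
qed

text \<open>
  The two factors are closed one after the other, each time multiplying by single elements of the
  other factor.
\<close>

lemma semistar_submodule_mult:
  assumes "semistar_operation star" "E \<in> nonzero_submodules" "F \<in> nonzero_submodules"
  shows "submodule_mult (star E) (star F) \<subseteq> star (submodule_mult E F)"
proof (rule submodule_mult_least)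
  note EF = submodule_mult_nonzero[OF assms(2,3)]
  show "fract_module.subspace (star (submodule_mult E F))"
    by (rule semistar_subspace[OF assms(1) EF])
  have *: "x * z \<in> star (submodule_mult E F)" if "x \<in> E" "z \<in> star F" for x z
    using that semistar_extensive[OF assms(1) EF]
    by (intro semistar_mult_closed[OF assms(1,3) EF, of x z]) (auto intro: submodule_multI)
  fix x z assume "x \<in> star E" "z \<in> star F"
  then have "z * x \<in> star (submodule_mult E F)"
    using * by (intro semistar_mult_closed[OF assms(1,2) EF, of z x]) (auto simp: mult.commute)
  then show "x * z \<in> star (submodule_mult E F)" by (simp add: mult.commute)
qed

lemma star_mult_eq_unit_iff:
  assumes "semistar_operation star" "I \<in> nonzero_submodules" "C \<in> nonzero_submodules"
    and "submodule_mult I C \<subseteq> star dom_in_fract"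
  shows "star (submodule_mult I C) = star dom_in_fract \<longleftrightarrow> 1 \<in> star (submodule_mult I C)"
proof
  note D = fg_imp_nonzero[OF dom_in_fract_fg]
  note IC = submodule_mult_nonzero[OF assms(2,3)]
  show "1 \<in> star (submodule_mult I C)" if "star (submodule_mult I C) = star dom_in_fract"
    using that one_in_dom semistar_extensive[OF assms(1) D] by blast
  assume "1 \<in> star (submodule_mult I C)"
  then have "dom_in_fract \<subseteq> star (submodule_mult I C)"
    using dom_subset_iff semistar_subspace[OF assms(1) IC] by blast
  then show "star (submodule_mult I C) = star dom_in_fract"
    using semistar_least[OF assms(1) D IC] semistar_least[OF assms(1) IC D assms(4)] by blast
qed

lemma quasi_star_invertible_iff:
  fixes star :: "'a::idom fract set \<Rightarrow> 'a fract set"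
  assumes "semistar_operation star" "I \<in> nonzero_submodules"
  defines "C \<equiv> submodule_colon (star dom_in_fract) I"
  shows "quasi_star_invertible star I \<longleftrightarrow>
    C \<in> nonzero_submodules \<and> 1 \<in> star (submodule_mult I C)"
proof -
  have D: "fract_module.subspace (star dom_in_fract)"
    using assms(1) by (rule semistar_subspace) (rule fg_imp_nonzero[OF dom_in_fract_fg])
  have "submodule_mult I C \<subseteq> star dom_in_fract"
    by (rule submodule_mult_least[OF D]) (auto simp: C_def submodule_colon_def mult.commute)
  moreover have "C \<in> nonzero_submodules \<longleftrightarrow> C \<noteq> {0}"
    using subspace_colon[OF D] by (simp add: nonzero_submodules_def C_def)
  ultimately show ?thesis
    using star_mult_eq_unit_iff[OF assms(1,2), of C] assms(2)
    unfolding quasi_star_invertible_def C_def[symmetric] by blast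
qed

section \<open>The associated operation of finite type\<close>

lemma finite_type_ofE:
  assumes "x \<in> finite_type_of star E"
  obtains F where "F \<in> fg_nonzero_submodules" "F \<subseteq> E" "x \<in> star F"
  using assms by (auto simp: finite_type_of_def)

lemma finite_type_ofI:
  "F \<in> fg_nonzero_submodules \<Longrightarrow> F \<subseteq> E \<Longrightarrow> x \<in> star F \<Longrightarrow> x \<in> finite_type_of star E"
  by (auto simp: finite_type_of_def)

lemma finite_type_of_mono: "E \<subseteq> F \<Longrightarrow> finite_type_of star E \<subseteq> finite_type_of star F"
  unfolding finite_type_of_def by blast

lemma finite_type_of_subset:
  assumes "semistar_operation star" "E \<in> nonzero_submodules"
  shows "finite_type_of star E \<subseteq> star E"
  using semistar_mono[OF assms(1) _ assms(2)] by (auto elim!: finite_type_ofE dest: fg_imp_nonzero)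

lemma finite_type_of_fg:
  assumes "semistar_operation star" "F \<in> fg_nonzero_submodules"
  shows "finite_type_of star F = star F"
  using finite_type_of_subset[OF assms(1) fg_imp_nonzero[OF assms(2)]] finite_type_ofI[OF assms(2)]
  by blast

text \<open>
  The union defining \<open>E\<^sup>f\<close> is directed, so any finite subset of it is caught by a single member.
\<close>

lemma finite_subset_finite_type_of:
  assumes "semistar_operation star" "E \<in> nonzero_submodules"
    and "finite S" "S \<subseteq> finite_type_of star E"
  shows "\<exists>F \<in> fg_nonzero_submodules. F \<subseteq> E \<and> S \<subseteq> star F"
  using assms(3,4)
proof (induction S)
  case empty
  then show ?case using fg_submodule_exists[OF assms(2)] by auto
next
  case (insert s S)
  obtain F where F: "F \<in> fg_nonzero_submodules" "F \<subseteq> E" "S \<subseteq> star F"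
    using insert by auto
  obtain G where G: "G \<in> fg_nonzero_submodules" "G \<subseteq> E" "s \<in> star G"
    using insert.prems by (auto elim: finite_type_ofE)
  obtain H where H: "H \<in> fg_nonzero_submodules" "F \<subseteq> H" "G \<subseteq> H" "H \<subseteq> E"
    using fg_submodule_join[OF F(1) G(1) nonzero_submodulesD[OF assms(2)] F(2) G(2)] by blast
  have "star F \<subseteq> star H" "star G \<subseteq> star H"
    using F(1) G(1) H by (simp_all add: semistar_mono[OF assms(1)] fg_imp_nonzero)
  then show ?case using F(3) G(3) H(1,4) by blast
qed

text \<open>
  Each submodule axiom concerns finitely many elements, hence can be checked in a single \<open>F\<^sup>\<star>\<close>.
\<close>

lemma finite_type_of_nonzero:
  assumes "semistar_operation star" "E \<in> nonzero_submodules"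
  shows "finite_type_of star E \<in> nonzero_submodules"
proof -
  have closed: "z \<in> finite_type_of star E"
    if S: "finite S" "S \<subseteq> finite_type_of star E"
      and z: "\<And>T. fract_module.subspace T \<Longrightarrow> S \<subseteq> T \<Longrightarrow> z \<in> T" for z S
  proof -
    obtain F where F: "F \<in> fg_nonzero_submodules" "F \<subseteq> E" "S \<subseteq> star F"
      using finite_subset_finite_type_of[OF assms S] by blast
    then show ?thesis
      using z semistar_subspace[OF assms(1) fg_imp_nonzero[OF F(1)]] by (blast intro: finite_type_ofI)
  qed
  have "fract_module.subspace (finite_type_of star E)"
  proof (rule subspace_fractI)
    show "0 \<in> finite_type_of star E"
      by (rule closed[of "{}"]) (auto simp: fract_module.subspace_0)
  next
    fix x y assume "x \<in> finite_type_of star E" "y \<in> finite_type_of star E"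
    then show "x + y \<in> finite_type_of star E"
      by (intro closed[of "{x, y}"]) (auto simp: fract_module.subspace_add)
  next
    fix d x assume "x \<in> finite_type_of star E"
    then show "to_fract d * x \<in> finite_type_of star E"
      by (intro closed[of "{x}"]) (auto simp: subspace_scaleD)
  qed
  moreover obtain F where F: "F \<in> fg_nonzero_submodules" "F \<subseteq> E"
    using fg_submodule_exists[OF assms(2)] by blast
  moreover have "star F \<subseteq> finite_type_of star E"
    using F by (blast intro: finite_type_ofI)
  ultimately show ?thesis
    using nonzero_submodules_mono semistar_nonzero[OF assms(1) fg_imp_nonzero[OF F(1)]] by blast
qed

lemma finite_type_of_extensive:
  assumes "semistar_operation star" "E \<in> nonzero_submodules"
  shows "E \<subseteq> finite_type_of star E"
proof
  fix x assume x: "x \<in> E"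
  obtain F where F: "F \<in> fg_nonzero_submodules" "F \<subseteq> E"
    using fg_submodule_exists[OF assms(2)] by blast
  obtain S where S: "finite S" "F = fract_module.span S"
    using F(1) by (rule fg_nonzero_submodulesE)
  \<comment> \<open>Adjoining \<open>x\<close> to some nonzero \<open>F\<close> covers \<open>x = 0\<close>, where \<open>D x\<close> itself is not admissible.\<close>
  let ?G = "fract_module.span (insert x S)"
  have "F \<subseteq> ?G" unfolding S(2) by (rule fract_module.span_mono) blast
  then have "?G \<in> nonzero_submodules"
    using nonzero_submodules_mono[OF _ fg_imp_nonzero[OF F(1)]] by simp
  then have G: "?G \<in> fg_nonzero_submodules"
    using S(1) by (intro fg_nonzero_submodulesI) (auto simp: nonzero_submodules_def)
  have "?G \<subseteq> E"
    using x F(2) S(2) nonzero_submodulesD[OF assms(2)]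
    by (intro fract_module.span_minimal) (auto intro: fract_module.span_base)
  moreover have "x \<in> star ?G"
    using semistar_extensive[OF assms(1) fg_imp_nonzero[OF G]] fract_module.span_base[of x "insert x S"]
    by blast
  ultimately show "x \<in> finite_type_of star E" using G by (blast intro: finite_type_ofI)
qed

lemma finite_type_of_idem:
  assumes "semistar_operation star" "E \<in> nonzero_submodules"
  shows "finite_type_of star (finite_type_of star E) = finite_type_of star E"
proof
  show "finite_type_of star (finite_type_of star E) \<subseteq> finite_type_of star E"
  proof
    fix x assume "x \<in> finite_type_of star (finite_type_of star E)"
    then obtain F where F: "F \<in> fg_nonzero_submodules" "F \<subseteq> finite_type_of star E" "x \<in> star F"
      by (rule finite_type_ofE)
    obtain S where S: "finite S" "F = fract_module.span S"
      using F(1) by (rule fg_nonzero_submodulesE)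
    have "S \<subseteq> finite_type_of star E"
      using F(2) S(2) fract_module.span_superset by blast
    then obtain G where G: "G \<in> fg_nonzero_submodules" "G \<subseteq> E" "S \<subseteq> star G"
      using finite_subset_finite_type_of[OF assms S(1)] by blast
    have "F \<subseteq> star G"
      unfolding S(2)
      by (rule fract_module.span_minimal[OF G(3) semistar_subspace[OF assms(1) fg_imp_nonzero[OF G(1)]]])
    then have "star F \<subseteq> star G"
      using F(1) G(1) by (intro semistar_least[OF assms(1)] fg_imp_nonzero)
    then show "x \<in> finite_type_of star E"
      using F(3) G by (blast intro: finite_type_ofI)
  qed
qed (rule finite_type_of_extensive[OF assms(1) finite_type_of_nonzero[OF assms]])

lemma finite_type_of_scale:
  assumes "semistar_operation star" "E \<in> nonzero_submodules" "x \<noteq> 0"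
  shows "finite_type_of star ((\<lambda>y. x * y) ` E) = (\<lambda>y. x * y) ` finite_type_of star E"
proof -
  have le: "(\<lambda>y. x * y) ` finite_type_of star E \<subseteq> finite_type_of star ((\<lambda>y. x * y) ` E)"
    if "x \<noteq> 0" for x and E
  proof
    fix z assume "z \<in> (\<lambda>y. x * y) ` finite_type_of star E"
    then obtain F y where F: "F \<in> fg_nonzero_submodules" "F \<subseteq> E" "y \<in> star F" "z = x * y"
      by (auto elim: finite_type_ofE)
    then have "z \<in> star ((\<lambda>y. x * y) ` F)"
      using semistar_scale[OF assms(1) fg_imp_nonzero[OF F(1)] that] by blast
    then show "z \<in> finite_type_of star ((\<lambda>y. x * y) ` E)"
      by (rule finite_type_ofI[OF image_mult_fg[OF F(1) that] image_mono[OF F(2)]])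
  qed
  \<comment> \<open>The other inclusion is the one just shown, for the scalar \<open>x\<inverse>\<close> and the module \<open>x E\<close>.\<close>
  have "(\<lambda>y. inverse x * y) ` finite_type_of star ((\<lambda>y. x * y) ` E) \<subseteq> finite_type_of star E"
    using le[of "inverse x" "(\<lambda>y. x * y) ` E"] assms(3) by (simp add: image_mult_inverse)
  then have "finite_type_of star ((\<lambda>y. x * y) ` E) \<subseteq> (\<lambda>y. x * y) ` finite_type_of star E"
    using image_mono[of _ _ "\<lambda>y. x * y"] image_mult_inverse(2)[OF assms(3)] by metis
  then show ?thesis using le[OF assms(3)] by blast
qed

theorem semistar_finite_type_of:
  assumes "semistar_operation star"
  shows "semistar_operation (finite_type_of star)"
  unfolding semistar_operation_def
  by (intro conjI ballI allI impI finite_type_of_nonzero[OF assms] finite_type_of_scale[OF assms]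
      finite_type_of_mono finite_type_of_extensive[OF assms] finite_type_of_idem[OF assms])

section \<open>Finiteness and invertibility\<close>

text \<open>
  The witness does not change: \<open>J\<^sup>f = E\<^sup>f\<close> gives \<open>J \<subseteq> E\<^sup>f \<subseteq> E\<^sup>\<star>\<close> and \<open>E \<subseteq> J\<^sup>f = J\<^sup>\<star>\<close>.
\<close>

lemma star_finite_if_finite_type:
  assumes "semistar_operation star" "star_finite (finite_type_of star) E"
  shows "star_finite star E"
proof -
  obtain J where J: "J \<in> fg_nonzero_submodules" "finite_type_of star J = finite_type_of star E"
    and E: "E \<in> nonzero_submodules"
    using assms(2) by (auto simp: star_finite_def)
  have eq: "star J = finite_type_of star E"
    using J finite_type_of_fg[OF assms(1)] by simp
  have "star J \<subseteq> star E"
    unfolding eq by (rule finite_type_of_subset[OF assms(1) E])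
  moreover have "star E \<subseteq> star J"
    using finite_type_of_extensive[OF assms(1) E]
    by (intro semistar_least[OF assms(1) E fg_imp_nonzero[OF J(1)]]) (simp add: eq)
  ultimately show ?thesis using J(1) E by (auto simp: star_finite_def)
qed

text \<open>
  If \<open>I C \<subseteq> D\<^sup>\<star>\<close> and finitely generated \<open>G \<subseteq> I\<close>, \<open>H \<subseteq> C\<close> satisfy \<open>1 \<in> (G H)\<^sup>\<star>\<close>, then multiplying
  this membership by \<open>x \<in> I\<close> yields \<open>x \<in> G\<^sup>\<star>\<close>, because \<open>x h \<in> D\<^sup>\<star>\<close> for every \<open>h \<in> H\<close>. Stated for
  an arbitrary second factor \<open>C\<close>, it applies to the colon module as well, by symmetry.
\<close>

lemma star_finite_factor:
  assumes star: "semistar_operation star"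
    and I: "I \<in> nonzero_submodules" and C: "C \<in> nonzero_submodules"
    and IC: "submodule_mult I C \<subseteq> star dom_in_fract"
    and one: "1 \<in> finite_type_of star (submodule_mult I C)"
  shows "star_finite (finite_type_of star) I"
proof -
  note fin = semistar_finite_type_of[OF star]
  obtain L where L: "L \<in> fg_nonzero_submodules" "L \<subseteq> submodule_mult I C" "1 \<in> star L"
    using one by (rule finite_type_ofE)
  obtain G H where G: "G \<in> fg_nonzero_submodules" "G \<subseteq> I"
    and H: "H \<in> fg_nonzero_submodules" "H \<subseteq> C" and LGH: "L \<subseteq> submodule_mult G H"
    using fg_subset_submodule_mult[OF L(1,2) I[THEN nonzero_submodulesD] C[THEN nonzero_submodulesD]]
    by blast
  note nz = fg_imp_nonzero[OF G(1)] fg_imp_nonzero[OF H(1)] fg_imp_nonzero[OF dom_in_fract_fg]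
  note GH = submodule_mult_nonzero[OF nz(1,2)]
  have sub: "fract_module.subspace (star G)" by (rule semistar_subspace[OF star nz(1)])
  have one': "1 \<in> star (submodule_mult G H)"
    using L(3) semistar_mono[OF star fg_imp_nonzero[OF L(1)] GH LGH] by blast
  have I_sub: "I \<subseteq> star G"
  proof
    fix x assume x: "x \<in> I"
    have prod: "(g * h) * x \<in> star G" if g: "g \<in> G" and h: "h \<in> H" for g h
    proof -
      have "g * y \<in> star G" if "y \<in> dom_in_fract" for y
        using that g semistar_extensive[OF star nz(1)] subspace_scaleD[OF sub, of g]
        by (auto simp: dom_in_fract_def mult.commute)
      moreover have "x * h \<in> star dom_in_fract"
        using x h H(2) IC submodule_multI[of x I h C] by blast
      ultimately have "g * (x * h) \<in> star G"
        by (rule semistar_mult_closed[OF star nz(3,1)])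
      then show ?thesis by (simp add: ac_simps)
    qed
    have "submodule_mult G H \<subseteq> submodule_colon (star G) {x}"
      by (rule submodule_mult_least[OF subspace_colon[OF sub]]) (simp add: submodule_colon_def prod)
    then have "x * y \<in> star G" if "y \<in> submodule_mult G H" for y
      using that by (auto simp: submodule_colon_def mult.commute)
    then have "x * 1 \<in> star G"
      using one' by (rule semistar_mult_closed[OF star GH nz(1)])
    then show "x \<in> star G" by simp
  qed
  then have "finite_type_of star I \<subseteq> finite_type_of star G"
    by (intro semistar_least[OF fin I nz(1)]) (simp add: finite_type_of_fg[OF star G(1)])
  then show ?thesis
    using finite_type_of_mono[OF G(2)] G(1) I by (auto simp: star_finite_def)
qed

text \<open>
  Passing from \<open>\<star>\<close> to \<open>\<star>\<^sub>f\<close>: closing the factors first replaces \<open>E F\<close> by a finitely generated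
  product, on which the two operations agree.
\<close>

lemma finite_type_of_mult_eq:
  assumes star: "semistar_operation star"
    and E: "star_finite (finite_type_of star) E" and F: "star_finite (finite_type_of star) F"
  shows "finite_type_of star (submodule_mult E F) = star (submodule_mult E F)"
proof
  note fin = semistar_finite_type_of[OF star]
  have nz: "E \<in> nonzero_submodules" "F \<in> nonzero_submodules"
    using E F by (auto simp: star_finite_def)
  note EF = submodule_mult_nonzero[OF nz]
  obtain G where G: "G \<in> fg_nonzero_submodules" "finite_type_of star G = finite_type_of star E"
    using E by (auto simp: star_finite_def)
  obtain H where H: "H \<in> fg_nonzero_submodules" "finite_type_of star H = finite_type_of star F"
    using F by (auto simp: star_finite_def)
  note nz' = fg_imp_nonzero[OF G(1)] fg_imp_nonzero[OF H(1)]
  note GH = submodule_mult_nonzero[OF nz']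
  have "submodule_mult E F \<subseteq> submodule_mult (star G) (star H)"
    using finite_type_of_extensive[OF star] nz G H finite_type_of_fg[OF star]
    by (intro submodule_mult_mono) metis+
  also have "\<dots> \<subseteq> star (submodule_mult G H)"
    by (rule semistar_submodule_mult[OF star nz'])
  finally have "star (submodule_mult E F) \<subseteq> star (submodule_mult G H)"
    by (rule semistar_least[OF star EF GH])
  also have "\<dots> = finite_type_of star (submodule_mult G H)"
    using finite_type_of_fg[OF star submodule_mult_fg[OF G(1) H(1)]] by simp
  also have "\<dots> \<subseteq> finite_type_of star (submodule_mult E F)"
  proof (rule semistar_least[OF fin GH EF])
    have "submodule_mult G H \<subseteq> submodule_mult (finite_type_of star E) (finite_type_of star F)"
      using finite_type_of_extensive[OF star] nz' G(2) H(2) by (intro submodule_mult_mono) metis+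
    also have "\<dots> \<subseteq> finite_type_of star (submodule_mult E F)"
      by (rule semistar_submodule_mult[OF fin nz])
    finally show "submodule_mult G H \<subseteq> finite_type_of star (submodule_mult E F)" .
  qed
  finally show "star (submodule_mult E F) \<subseteq> finite_type_of star (submodule_mult E F)" .
  show "finite_type_of star (submodule_mult E F) \<subseteq> star (submodule_mult E F)"
    by (rule finite_type_of_subset[OF star EF])
qed

theorem proposition2p15:
  fixes star :: "'a::idom fract set \<Rightarrow> 'a fract set"
    and I :: "'a fract set"
  assumes "semistar_operation star"
    and "I \<in> nonzero_submodules"
  shows "(quasi_star_invertible (finite_type_of star) I \<longleftrightarrow>
      star_finite (finite_type_of star) I \<and>
      star_finite (finite_type_of star) (submodule_colon (star dom_in_fract) I) \<and>
      quasi_star_invertible star I) \<and>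
    (star_finite (finite_type_of star) I \<longrightarrow> star_finite star I) \<and>
    (star_finite (finite_type_of star) (submodule_colon (star dom_in_fract) I) \<longrightarrow>
      star_finite star (submodule_colon (star dom_in_fract) I))"
proof -
  define C where "C = submodule_colon (star dom_in_fract) I"
  have inv: "quasi_star_invertible star I \<longleftrightarrow>
      C \<in> nonzero_submodules \<and> 1 \<in> star (submodule_mult I C)"
    unfolding C_def by (rule quasi_star_invertible_iff[OF assms])
  have inv_f: "quasi_star_invertible (finite_type_of star) I \<longleftrightarrow>
      C \<in> nonzero_submodules \<and> 1 \<in> finite_type_of star (submodule_mult I C)"
    using quasi_star_invertible_iff[OF semistar_finite_type_of[OF assms(1)] assms(2)]
    unfolding C_def finite_type_of_fg[OF assms(1) dom_in_fract_fg] .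
  have IC: "submodule_mult I C \<subseteq> star dom_in_fract"
    using semistar_subspace[OF assms(1) fg_imp_nonzero[OF dom_in_fract_fg]]
    by (rule submodule_mult_least) (auto simp: C_def submodule_colon_def mult.commute)
  have "star_finite (finite_type_of star) I \<and> star_finite (finite_type_of star) C \<and>
      quasi_star_invertible star I" if "quasi_star_invertible (finite_type_of star) I"
  proof -
    have C: "C \<in> nonzero_submodules" and one: "1 \<in> finite_type_of star (submodule_mult I C)"
      using that inv_f by simp_all
    have "star_finite (finite_type_of star) I"
      by (rule star_finite_factor[OF assms C IC one])
    moreover have "star_finite (finite_type_of star) C"
      using star_finite_factor[OF assms(1) C assms(2)] IC one
      by (simp add: submodule_mult_commute[of C I])
    moreover have "quasi_star_invertible star I"
      using one C inv finite_type_of_subset[OF assms(1) submodule_mult_nonzero[OF assms(2) C]] by blast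
    ultimately show ?thesis by blast
  qed
  moreover have "quasi_star_invertible (finite_type_of star) I"
    if "star_finite (finite_type_of star) I" "star_finite (finite_type_of star) C"
      "quasi_star_invertible star I"
    using that inv inv_f finite_type_of_mult_eq[OF assms(1)] by simp
  ultimately show ?thesis
    using star_finite_if_finite_type[OF assms(1)] unfolding C_def by blast
qed

end
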